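(* For every integer $n\ge 1$, $$|RAI_{2n-1}(4321)|=M_n-M_{n-2},$$ where $M_k$ is the $k$-th Motzkin number and $M_{k}=0$ for $k<0$.
   Context: Let $S_n$ be the set of permutations $\pi=\pi_1\ldots\pi_n$ of $\{1,\ldots,n\}$. A permutation is reverse alternating if, for all $1\le i\le n-1$, $\pi_i>\pi_{i+1}$ if and only if $i$ is odd. $RAI_n$ is the set of reverse alternating involutions ($\pi=\pi^{-1}$) in $S_n$. A permutation $\pi\in S_n$ avoids the pattern $\tau\in S_k$ if there are no indices $i_1<\cdots<i_k$ such that $\pi_{i_1}\ldots\pi_{i_k}$ is order-isomorphic to $\tau$; $RAI_n(\tau)$ is the set of elements of $RAI_n$ avoiding $\tau$. The Motzkin number $M_n$ ($n\ge 0$) is the number of Motzkin paths of length $n$, i.e. lattice paths from $(0,0)$ to $(n,0)$ with steps $U=(1,1)$, $D=(1,-1)$, $H=(1,0)$ that stay weakly above the $x$-axis (so $M_0=M_1=1$, $M_2=2$, $M_3=4$). *)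

theory Defs
  imports Complex_Main "HOL-Combinatorics.Permutations"
begin

(* A permutation of {1,...,n} is a function on the natural numbers with p permutes {1..n},
   so it is the identity outside {1..n}. *)

definition reverse_alternating :: "nat \<Rightarrow> (nat \<Rightarrow> nat) \<Rightarrow> bool" where
  "reverse_alternating n p \<longleftrightarrow> (\<forall>i. 1 \<le> i \<and> i + 1 \<le> n \<longrightarrow> (p i > p (i + 1) \<longleftrightarrow> odd i))"

definition RAI :: "nat \<Rightarrow> (nat \<Rightarrow> nat) set" where
  "RAI n = {p. p permutes {1..n} \<and> inv p = p \<and> reverse_alternating n p}"

(* The indices i_1 < ... < i_k of an occurrence are the values of idx on {1..k}. *)
definition contains_pattern :: "nat \<Rightarrow> (nat \<Rightarrow> nat) \<Rightarrow> nat \<Rightarrow> (nat \<Rightarrow> nat) \<Rightarrow> bool" where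
  "contains_pattern n p k t \<longleftrightarrow>
     (\<exists>idx :: nat \<Rightarrow> nat. strict_mono_on {1..k} idx \<and> idx ` {1..k} \<subseteq> {1..n} \<and>
        (\<forall>a\<in>{1..k}. \<forall>b\<in>{1..k}. p (idx a) < p (idx b) \<longleftrightarrow> t a < t b))"

definition RAI_avoiding :: "nat \<Rightarrow> nat \<Rightarrow> (nat \<Rightarrow> nat) \<Rightarrow> (nat \<Rightarrow> nat) set" where
  "RAI_avoiding n k t = {p \<in> RAI n. \<not> contains_pattern n p k t}"

(* One-line notation: the word t_1 ... t_k as a function on positions 1..k. *)
definition perm_of_word :: "nat list \<Rightarrow> nat \<Rightarrow> nat" where
  "perm_of_word w i = (if 1 \<le> i \<and> i \<le> length w then w ! (i - 1) else i)"

datatype motzkin_step = Up | Down | Horiz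

fun step_rise :: "motzkin_step \<Rightarrow> int" where
  "step_rise Up = 1"
| "step_rise Down = -1"
| "step_rise Horiz = 0"

(* Every step advances the x-coordinate by one, so after j steps the path is at the point
   (j, path_height (take j s)). *)
definition path_height :: "motzkin_step list \<Rightarrow> int" where
  "path_height s = (\<Sum>x\<leftarrow>s. step_rise x)"

definition motzkin_paths :: "nat \<Rightarrow> motzkin_step list set" where
  "motzkin_paths n = {s. length s = n \<and> path_height s = 0 \<and> (\<forall>j\<le>n. path_height (take j s) \<ge> 0)}"

definition motzkin :: "int \<Rightarrow> int" where
  "motzkin k = (if k < 0 then 0 else int (card (motzkin_paths (nat k))))"

end

theory Submission
  imports Defs
begin

text \<open>
  An involution avoids 4321 iff no arc of it lies strictly inside another one; fixed points may
  lie below arcs. Such an involution is determined by which positions open an arc (up step), close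
  an arc (down step) or are fixed (horizontal step), since the k-th opening position is matched
  with the k-th closing one; every Motzkin path arises in this way. A descent of the involution
  is exactly a place where the rise of the path drops, so one has to count the Motzkin paths of
  length 2n-1 whose steps alternately drop and do not drop. The first n-1 pairs of steps are UH,
  HD or UD, and reading these as U, D, H gives, with the last step kept, a Motzkin path of length
  n. The only excluded paths are those ending in UD, of which there are as many as Motzkin paths
  of length n-2.
\<close>

section \<open>Motzkin paths with alternating steps\<close>

text \<open>The starting height is a parameter so that induction over the steps goes through. The
  end point needs no separate sign test, because \<open>h = 0\<close> is required there.\<close>

fun motzkin_from :: "int \<Rightarrow> motzkin_step list \<Rightarrow> bool" where
  "motzkin_from h [] \<longleftrightarrow> h = 0"
| "motzkin_from h (x # s) \<longleftrightarrow> 0 \<le> h \<and> motzkin_from (h + step_rise x) s"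

lemma motzkin_from_iff:
  "motzkin_from h s \<longleftrightarrow>
    h + path_height s = 0 \<and> (\<forall>j\<le>length s. 0 \<le> h + path_height (take j s))"
proof (induction s arbitrary: h)
  case Nil
  then show ?case by (auto simp: path_height_def)
next
  case (Cons x s)
  have "(\<forall>j\<le>length (x # s). 0 \<le> h + path_height (take j (x # s))) \<longleftrightarrow>
    0 \<le> h \<and> (\<forall>j\<le>length s. 0 \<le> h + step_rise x + path_height (take j s))"
    by (auto simp: path_height_def add.assoc take_Cons' all_conj_distrib)
  then show ?case
    using Cons[of "h + step_rise x"] by (auto simp: path_height_def add.assoc)
qed

lemma motzkin_paths_eq: "motzkin_paths n = {s. length s = n \<and> motzkin_from 0 s}"
  by (auto simp: motzkin_paths_def motzkin_from_iff)

lemma finite_motzkin_paths: "finite (motzkin_paths n)"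
proof -
  have "(UNIV :: motzkin_step set) = {Up, Down, Horiz}"
    using motzkin_step.exhaust by blast
  then have "finite (UNIV :: motzkin_step set)"
    by (metis finite.emptyI finite.insertI)
  then have "finite {s :: motzkin_step list. length s = n}"
    using finite_lists_length_eq[of "UNIV :: motzkin_step set" n] by simp
  then show ?thesis
    by (rule rev_finite_subset) (auto simp: motzkin_paths_def)
qed

section \<open>Alternating step sequences and their reading in pairs\<close>

fun alternates :: "bool \<Rightarrow> motzkin_step list \<Rightarrow> bool" where
  "alternates b (x # y # s) \<longleftrightarrow> (step_rise y < step_rise x \<longleftrightarrow> b) \<and> alternates (\<not> b) (y # s)"
| "alternates b s \<longleftrightarrow> True"

text \<open>Links the recursion to the position-wise form of \<open>reverse_alternating\<close>.
  List indices start at 0, so odd positions become even indices.\<close>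

lemma alternates_iff:
  "alternates b s \<longleftrightarrow>
    (\<forall>i. Suc i < length s \<longrightarrow> (step_rise (s ! Suc i) < step_rise (s ! i) \<longleftrightarrow> (even i \<longleftrightarrow> b)))"
proof (induction b s rule: alternates.induct)
  case (1 b x y s)
  let ?P = "\<lambda>i. Suc i < length (x # y # s) \<longrightarrow>
    (step_rise ((x # y # s) ! Suc i) < step_rise ((x # y # s) ! i) \<longleftrightarrow> (even i \<longleftrightarrow> b))"
  have "(\<forall>i. Q i) \<longleftrightarrow> Q 0 \<and> (\<forall>i. Q (Suc i))" for Q :: "nat \<Rightarrow> bool"
    by (metis not0_implies_Suc)
  then have "(\<forall>i. ?P i) \<longleftrightarrow> ?P 0 \<and> (\<forall>i. ?P (Suc i))" .
  then show ?case using 1 by (cases b) simp_all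
qed auto

text \<open>The three values are exactly the pairs with a strict drop, and each has the total rise
  of the step it encodes.\<close>

fun expand_step :: "motzkin_step \<Rightarrow> motzkin_step list" where
  "expand_step Up = [Up, Horiz]"
| "expand_step Down = [Horiz, Down]"
| "expand_step Horiz = [Up, Down]"

fun expand :: "motzkin_step list \<Rightarrow> motzkin_step list" where
  "expand (x # y # s) = expand_step x @ expand (y # s)"
| "expand s = s"

text \<open>Each block has the same total rise as its step, and its middle point is never below its
  starting point, so expansion adds no new height condition.\<close>

lemma motzkin_from_expand: "motzkin_from h (expand s) \<longleftrightarrow> motzkin_from h s"
proof (induction s arbitrary: h rule: expand.induct)
  case (1 x y s)
  show ?case by (cases x) (auto simp: "1.IH")
qed simp_all

lemma length_expand: "length (expand s) = 2 * length s - 1"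
proof (induction s rule: expand.induct)
  case (1 x y s)
  then show ?case by (cases x) auto
qed auto

lemma expand_step_inject: "expand_step x @ s = expand_step y @ t \<longleftrightarrow> x = y \<and> s = t"
  by (cases x; cases y) auto

lemma inj_expand: "inj_on expand {s. length s = n}"
proof -
  have "length t = length s \<Longrightarrow> expand s = expand t \<Longrightarrow> s = t" for s t
  proof (induction s arbitrary: t rule: expand.induct)
    case (1 x y s)
    then obtain x' y' t' where t: "t = x' # y' # t'"
      by (auto simp: length_Suc_conv)
    show ?case
      using "1.IH"[of "y' # t'"] "1.prems" by (simp add: t expand_step_inject)
  qed (auto simp: length_Suc_conv)
  then show ?thesis by (auto simp: inj_on_def)
qed

lemma alternates_imp_expand:
  assumes "alternates True s" "length s = 2 * n + 1"
  shows "\<exists>t. length t = Suc n \<and> s = expand t"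
  using assms
proof (induction n arbitrary: s)
  case 0
  then show ?case by (auto simp: length_Suc_conv intro!: exI[of _ s])
next
  case (Suc n)
  then obtain x y z s' where s: "s = x # y # z # s'"
    by (auto simp: length_Suc_conv)
  obtain t where t: "length t = Suc n" "z # s' = expand t"
    using Suc.IH[of "z # s'"] Suc.prems by (auto simp: s)
  have "step_rise y < step_rise x" using Suc.prems by (simp add: s)
  then obtain u where "[x, y] = expand_step u"
    by (cases x; cases y) (auto intro: that[of Up] that[of Down] that[of Horiz])
  \<comment> \<open>Since \<open>t\<close> is nonempty, the first equation of \<open>expand\<close>
    applies.\<close>
  then have "s = expand (u # t)"
    using t by (cases t) (auto simp: s simp flip: append_Cons append_Nil)
  then show ?case using t by (auto intro!: exI[of _ "u # t"])
qed

text \<open>Every block drops inside. A block ends in \<open>Horiz\<close> or \<open>Down\<close>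
  and the next one begins with \<open>Up\<close> or \<open>Horiz\<close>, so there is no drop
  between blocks. Only the kept last step can go wrong: it must be \<open>Down\<close> after a block
  ending in \<open>Horiz\<close>, which is the block of \<open>Up\<close>.\<close>

lemma alternates_expand: "alternates True (expand s) \<longleftrightarrow> (\<nexists>r. s = r @ [Up, Down])"
proof (induction s rule: expand.induct)
  case (1 x y s)
  show ?case
  proof (cases s)
    case Nil
    have "(\<exists>r. [x, y] = r @ [Up, Down]) \<longleftrightarrow> x = Up \<and> y = Down"
      by (auto simp: Cons_eq_append_conv)
    then show ?thesis by (cases x; cases y) (auto simp: Nil)
  next
    case (Cons z s')
    have "(\<exists>r. x # y # s = r @ [Up, Down]) \<longleftrightarrow> (\<exists>r. y # s = r @ [Up, Down])"
      by (auto simp: Cons Cons_eq_append_conv)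
    moreover have "alternates True (expand (x # y # s)) \<longleftrightarrow> alternates True (expand (y # s))"
      by (cases x; cases y) (auto simp: Cons)
    ultimately show ?thesis using 1 by simp
  qed
qed (auto simp: Cons_eq_append_conv)

lemma motzkin_from_append_peak: "motzkin_from h (r @ [Up, Down]) \<longleftrightarrow> motzkin_from h r"
  by (induction r arbitrary: h) auto

lemma card_alternating_motzkin_paths:
  assumes "n \<ge> 1"
  shows "int (card {s \<in> motzkin_paths (2 * n - 1). alternates True s})
    = motzkin (int n) - motzkin (int n - 2)"
proof -
  let ?peak = "\<lambda>r. r @ [Up, Down]"
  let ?E = "{t \<in> motzkin_paths n. \<exists>r. t = ?peak r}"
  have "{s \<in> motzkin_paths (2 * n - 1). alternates True s} = expand ` (motzkin_paths n - ?E)"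
  proof (intro equalityI subsetI)
    fix s assume s: "s \<in> {s \<in> motzkin_paths (2 * n - 1). alternates True s}"
    then have "length s = 2 * (n - 1) + 1" using assms by (auto simp: motzkin_paths_eq)
    then obtain t where "length t = n" "s = expand t"
      using alternates_imp_expand[of s "n - 1"] s assms by auto
    then show "s \<in> expand ` (motzkin_paths n - ?E)"
      using s by (auto simp: motzkin_paths_eq motzkin_from_expand alternates_expand)
  next
    fix s assume "s \<in> expand ` (motzkin_paths n - ?E)"
    then show "s \<in> {s \<in> motzkin_paths (2 * n - 1). alternates True s}"
      by (auto simp: motzkin_paths_eq motzkin_from_expand alternates_expand length_expand)
  qed
  moreover have "inj_on expand (motzkin_paths n - ?E)"
    using inj_expand[of n] by (rule inj_on_subset) (auto simp: motzkin_paths_eq)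
  ultimately have "card {s \<in> motzkin_paths (2 * n - 1). alternates True s}
      = card (motzkin_paths n - ?E)"
    by (simp add: card_image)
  also have "int \<dots> = int (card (motzkin_paths n)) - int (card ?E)"
    using finite_motzkin_paths[of n]
    by (subst card_Diff_subset) (auto intro: finite_subset card_mono of_nat_diff)
  also have "int (card ?E) = motzkin (int n - 2)"
  \<comment> \<open>For \<open>n = 1\<close> no path ends in a peak, which agrees with the value 0
    of \<open>motzkin\<close> at -1.\<close>
  proof (cases "n < 2")
    case True
    then have "?E = {}" by (auto simp: motzkin_paths_eq)
    then have "card ?E = 0" by (simp only: card.empty)
    then show ?thesis using True by (simp add: motzkin_def)
  next
    case False
    then have "?E = ?peak ` motzkin_paths (n - 2)"
      by (auto simp: motzkin_paths_eq motzkin_from_append_peak)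
    then have "card ?E = card (motzkin_paths (n - 2))"
      by (simp add: card_image inj_on_def)
    moreover have "nat (int n - 2) = n - 2" by simp
    ultimately show ?thesis using False by (simp add: motzkin_def)
  qed
  finally show ?thesis by (simp add: motzkin_def)
qed

section \<open>Nonnesting involutions\<close>

text \<open>If \<open>p a \<le> a\<close>, the inequality is automatic. For an involution this
  therefore says that no arc lies strictly inside another, phrased as: values at openers are
  left-to-right maxima.\<close>

definition nonnesting :: "(nat \<Rightarrow> nat) \<Rightarrow> bool" where
  "nonnesting p \<longleftrightarrow> (\<forall>a b. a < b \<and> b < p b \<longrightarrow> p a < p b)"

definition involutions :: "nat \<Rightarrow> (nat \<Rightarrow> nat) set" where
  "involutions n = {p. p permutes {1..n} \<and> inv p = p}"

lemma involutions_iff: "p \<in> involutions n \<longleftrightarrow> (\<forall>x. p (p x) = x) \<and> (\<forall>x. x \<notin> {1..n} \<longrightarrow> p x = x)"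
proof
  assume "p \<in> involutions n"
  then show "(\<forall>x. p (p x) = x) \<and> (\<forall>x. x \<notin> {1..n} \<longrightarrow> p x = x)"
    using permutes_inverses(1)[of p "{1..n}"] permutes_not_in[of p "{1..n}"]
    by (simp add: involutions_def)
next
  assume *: "(\<forall>x. p (p x) = x) \<and> (\<forall>x. x \<notin> {1..n} \<longrightarrow> p x = x)"
  have "\<exists>!x. p x = y" for y
    using * by (intro ex1I[of _ "p y"]) auto
  then have "p permutes {1..n}" using * by (simp add: permutes_def)
  moreover have "inv p = p" using * by (intro inv_equality) auto
  ultimately show "p \<in> involutions n" by (simp add: involutions_def)
qed

section \<open>Avoidance of 4321 and nested arcs\<close>

lemma contains_decreasing_iff:
  "contains_pattern n p 4 (perm_of_word [4, 3, 2, 1]) \<longleftrightarrow>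
    (\<exists>a b c d. 1 \<le> a \<and> a < b \<and> b < c \<and> c < d \<and> d \<le> n \<and> p d < p c \<and> p c < p b \<and> p b < p a)"
proof -
  have I: "{1..4} = {1, 2, 3, 4 :: nat}" by auto
  have w: "perm_of_word [4, 3, 2, 1] 1 = 4" "perm_of_word [4, 3, 2, 1] 2 = 3"
    "perm_of_word [4, 3, 2, 1] 3 = 2" "perm_of_word [4, 3, 2, 1] 4 = 1"
    by (simp_all add: perm_of_word_def eval_nat_numeral)
  show ?thesis
  proof
    assume "contains_pattern n p 4 (perm_of_word [4, 3, 2, 1])"
    then obtain f where f: "strict_mono_on {1..4} f" "f ` {1..4} \<subseteq> {1..n}"
      "\<forall>a\<in>{1..4}. \<forall>b\<in>{1..4}. p (f a) < p (f b) \<longleftrightarrow>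
         perm_of_word [4, 3, 2, 1] a < perm_of_word [4, 3, 2, 1] b"
      unfolding contains_pattern_def by blast
    have "f 1 < f 2" "f 2 < f 3" "f 3 < f 4"
      using f(1) by (auto simp: strict_mono_on_def)
    moreover have "1 \<le> f 1" "f 4 \<le> n" using f(2) unfolding I by auto
    moreover have "p (f 4) < p (f 3)" "p (f 3) < p (f 2)" "p (f 2) < p (f 1)"
      using f(3) unfolding I by (simp_all add: w del: One_nat_def)
    ultimately show "\<exists>a b c d. 1 \<le> a \<and> a < b \<and> b < c \<and> c < d \<and> d \<le> n \<and>
      p d < p c \<and> p c < p b \<and> p b < p a" by blast
  next
    assume "\<exists>a b c d. 1 \<le> a \<and> a < b \<and> b < c \<and> c < d \<and> d \<le> n \<and>
      p d < p c \<and> p c < p b \<and> p b < p a"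
    then obtain a b c d where *: "1 \<le> a" "a < b" "b < c" "c < d" "d \<le> n"
      "p d < p c" "p c < p b" "p b < p a" by blast
    \<comment> \<open>\<open>perm_of_word\<close> is borrowed here to write down an index function
      with prescribed values at 1, ..., 4.\<close>
    let ?f = "perm_of_word [a, b, c, d]"
    have f: "?f 1 = a" "?f 2 = b" "?f 3 = c" "?f 4 = d"
      by (simp_all add: perm_of_word_def eval_nat_numeral)
    show "contains_pattern n p 4 (perm_of_word [4, 3, 2, 1])"
      unfolding contains_pattern_def I
      by (rule exI[of _ ?f]) (use * in \<open>auto simp: f w strict_mono_on_def simp del: One_nat_def\<close>)
  qed
qed

text \<open>Nested arcs \<open>a < b < p b < p a\<close> form an occurrence on these four positions.
  Conversely, in an occurrence \<open>a < b < c < d\<close> the larger value at \<open>a\<close>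
  forces \<open>p b \<le> b\<close>, and dually \<open>c \<le> p c\<close>, which contradicts
  \<open>p c < p b\<close>.\<close>

lemma avoids_decreasing_iff_nonnesting:
  assumes "p \<in> involutions n"
  shows "\<not> contains_pattern n p 4 (perm_of_word [4, 3, 2, 1]) \<longleftrightarrow> nonnesting p"
proof -
  have inv: "p (p x) = x" and out: "x \<notin> {1..n} \<Longrightarrow> p x = x" for x
    using assms by (auto simp: involutions_iff)
  show ?thesis
  proof (rule iffI; rule ccontr)
    assume av: "\<not> contains_pattern n p 4 (perm_of_word [4, 3, 2, 1])" and "\<not> nonnesting p"
    then obtain a b where ab: "a < b" "b < p b" "\<not> p a < p b"
      by (auto simp: nonnesting_def)
    then have "p b < p a" by (metis inv linorder_neqE_nat less_irrefl)
    moreover from this have "a \<in> {1..n}" "p a \<in> {1..n}"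
      using ab out[of a] out[of "p a"] inv[of a] by force+
    ultimately show False
      using av ab inv[of a] inv[of b] unfolding contains_decreasing_iff
      by (metis atLeastAtMost_iff)
  next
    assume nn: "nonnesting p" and "\<not> \<not> contains_pattern n p 4 (perm_of_word [4, 3, 2, 1])"
    then obtain a b c d where *: "a < b" "b < c" "c < d" "p d < p c" "p c < p b" "p b < p a"
      unfolding contains_decreasing_iff by blast
    have "p b \<le> b" using nn * unfolding nonnesting_def by (meson not_le order.asym)
    moreover have "c \<le> p c"
      using nn *(3,4) inv unfolding nonnesting_def by (metis not_le order.asym)
    ultimately show False using * by simp
  qed
qed

section \<open>The step sequence of an involution\<close>

definition step_at :: "(nat \<Rightarrow> nat) \<Rightarrow> nat \<Rightarrow> motzkin_step" where
  "step_at p i = (if i < p i then Up else if p i < i then Down else Horiz)"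

definition shape :: "nat \<Rightarrow> (nat \<Rightarrow> nat) \<Rightarrow> motzkin_step list" where
  "shape n p = map (step_at p) [1..<Suc n]"

lemma length_shape [simp]: "length (shape n p) = n"
  by (simp add: shape_def)

text \<open>Descents of \<open>p\<close> are drops of the rise. Nonnesting gives an ascent into an
  opener and between two adjacent closers; the remaining cases follow by comparing values with
  positions.\<close>

lemma reverse_alternating_iff:
  assumes "p \<in> involutions n" "nonnesting p"
  shows "reverse_alternating n p \<longleftrightarrow> alternates True (shape n p)"
proof -
  have inv: "p (p x) = x" for x using assms by (auto simp: involutions_iff)
  have step: "p (Suc i) < p i \<longleftrightarrow> step_rise (step_at p (Suc i)) < step_rise (step_at p i)" for i
  proof -
    have up: "Suc i < p (Suc i) \<Longrightarrow> p i < p (Suc i)"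
      using assms(2) by (auto simp: nonnesting_def)
    have down: "p (Suc i) < Suc i \<Longrightarrow> p i < i \<Longrightarrow> p i < p (Suc i)"
    proof (rule ccontr)
      assume *: "p (Suc i) < Suc i" "p i < i" "\<not> p i < p (Suc i)"
      then have "p (Suc i) < p i" using inv by (metis linorder_neqE_nat n_not_Suc_n)
      \<comment> \<open>Nonnesting is applied to the left ends \<open>p (Suc i) < p i\<close> of the
        two arcs; it would give \<open>Suc i < i\<close>.\<close>
      then have "p (p (Suc i)) < p (p i)"
        using assms(2) * inv[of i] unfolding nonnesting_def by metis
      then show False by (simp add: inv)
    qed
    have ne: "p i \<noteq> p (Suc i)" by (metis inv n_not_Suc_n)
    \<comment> \<open>Next to a fixed point the comparison of values with positions is only weak;
      injectivity makes it strict.\<close>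
    have horiz: "p (Suc i) = Suc i \<Longrightarrow> p i \<noteq> Suc i" "p i = i \<Longrightarrow> p (Suc i) \<noteq> i"
      using ne by auto
    show ?thesis
      using up down ne horiz
      by (cases "i < p i"; cases "p i = i"; cases "Suc i < p (Suc i)"; cases "p (Suc i) = Suc i")
        (auto simp: step_at_def)
  qed
  have "reverse_alternating n p \<longleftrightarrow>
      (\<forall>i. Suc i < n \<longrightarrow> (p (Suc (Suc i)) < p (Suc i) \<longleftrightarrow> even i))"
    unfolding reverse_alternating_def
    by (auto simp: Suc_le_eq) (metis Suc_pred even_Suc)+
  then show ?thesis
    by (simp add: alternates_iff step shape_def del: upt_Suc)
qed

section \<open>Ranks of elements in finite sets, counted from 1\<close>

definition rank :: "nat set \<Rightarrow> nat \<Rightarrow> nat" where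
  "rank S i = card {j \<in> S. j \<le> i}"

lemma rank_less:
  assumes "finite S" "j \<in> S" "i < j"
  shows "rank S i < rank S j"
proof -
  have "{k \<in> S. k \<le> i} \<subseteq> {k \<in> S. k \<le> j}" "j \<in> {k \<in> S. k \<le> j} - {k \<in> S. k \<le> i}"
    using assms by auto
  then show ?thesis
    unfolding rank_def using assms(1) by (intro psubset_card_mono) auto
qed

lemma inj_on_rank: "finite S \<Longrightarrow> inj_on (rank S) S"
  by (rule linorder_inj_onI') (metis rank_less less_irrefl)

text \<open>On \<open>S\<close> the rank is strictly increasing, hence injective, and its target has
  just \<open>card S\<close> elements.\<close>

lemma bij_betw_rank:
  assumes "finite S"
  shows "bij_betw (rank S) S {1..card S}"
proof -
  have "rank S ` S \<subseteq> {1..card S}"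
  proof
    fix k assume "k \<in> rank S ` S"
    then obtain i where "i \<in> S" "k = card {j \<in> S. j \<le> i}" by (auto simp: rank_def)
    moreover have "i \<in> {j \<in> S. j \<le> i}" using \<open>i \<in> S\<close> by simp
    ultimately show "k \<in> {1..card S}"
      using assms by (auto simp: Suc_le_eq card_gt_0_iff intro: card_mono)
  qed
  moreover have "card (rank S ` S) = card S"
    using inj_on_rank[OF assms] by (rule card_image)
  ultimately have "rank S ` S = {1..card S}"
    by (intro card_subset_eq) auto
  then show ?thesis using inj_on_rank[OF assms] by (simp add: bij_betw_def)
qed

section \<open>The bijection between nonnesting involutions and Motzkin paths\<close>

lemma path_height_eq_card:
  "path_height (map w [1..<Suc j]) =
    int (card {i \<in> {1..j}. w i = Up}) - int (card {i \<in> {1..j}. w i = Down})"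
proof (induction j)
  case 0
  then show ?case by (simp add: path_height_def)
next
  case (Suc j)
  have *: "{i \<in> {1..Suc j}. w i = x} =
      (if w (Suc j) = x then insert (Suc j) else id) {i \<in> {1..j}. w i = x}" for x
    by (auto simp: le_Suc_eq)
  have "path_height (map w [1..<Suc (Suc j)]) =
      path_height (map w [1..<Suc j]) + step_rise (w (Suc j))"
    by (simp add: path_height_def)
  then show ?case
    unfolding Suc * by (cases "w (Suc j)") simp_all
qed

text \<open>The ballot form of the path condition, in which heights become comparisons of ranks
  among openers and closers.\<close>

lemma motzkin_paths_map_iff:
  "map w [1..<Suc n] \<in> motzkin_paths n \<longleftrightarrow>
    card {i \<in> {1..n}. w i = Up} = card {i \<in> {1..n}. w i = Down} \<and>
    (\<forall>j\<le>n. card {i \<in> {1..j}. w i = Down} \<le> card {i \<in> {1..j}. w i = Up})"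
proof -
  have "take j (map w [1..<Suc n]) = map w [1..<Suc j]" if "j \<le> n" for j
    using that by (simp add: take_map take_upt del: upt_Suc)
  then show ?thesis
    by (auto simp: motzkin_paths_def path_height_eq_card simp del: upt_Suc One_nat_def)
qed

text \<open>Since \<open>p\<close> sends closers up to \<open>j\<close> injectively to openers up to
  \<open>j\<close>, no prefix has more downs than ups. On all of \<open>{1..n}\<close> it also
  injects openers into closers, so the totals agree.\<close>

lemma shape_in_motzkin_paths:
  assumes "p \<in> involutions n"
  shows "shape n p \<in> motzkin_paths n"
proof -
  have inv: "p (p x) = x" and out: "x \<notin> {1..n} \<Longrightarrow> p x = x" for x
    using assms by (auto simp: involutions_iff)
  have inj: "inj p" by (metis inv injI)
  have range: "p x \<in> {1..n} \<longleftrightarrow> x \<in> {1..n}" for x by (metis inv out)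
  have Up: "step_at p i = Up \<longleftrightarrow> i < p i" and Down: "step_at p i = Down \<longleftrightarrow> p i < i" for i
    by (auto simp: step_at_def)
  have le: "card {i \<in> {1..j}. p i < i} \<le> card {i \<in> {1..j}. i < p i}" if "j \<le> n" for j
  proof (rule card_inj_on_le[of p])
    show "p ` {i \<in> {1..j}. p i < i} \<subseteq> {i \<in> {1..j}. i < p i}"
      using that range by (fastforce simp: inv)
  qed (use inj in \<open>auto intro: inj_on_subset\<close>)
  have "card {i \<in> {1..n}. i < p i} \<le> card {i \<in> {1..n}. p i < i}"
  proof (rule card_inj_on_le[of p])
    show "p ` {i \<in> {1..n}. i < p i} \<subseteq> {i \<in> {1..n}. p i < i}"
      using range by (fastforce simp: inv)
  qed (use inj in \<open>auto intro: inj_on_subset\<close>)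
  then have "card {i \<in> {1..n}. i < p i} = card {i \<in> {1..n}. p i < i}"
    using le[of n] by simp
  then show ?thesis
    unfolding shape_def motzkin_paths_map_iff Up Down using le by blast
qed

text \<open>The k-th opener is matched with the k-th closer, because \<open>p\<close> maps the
  openers up to \<open>i\<close> onto the closers up to \<open>p i\<close>.\<close>

lemma rank_nonnesting:
  assumes "p \<in> involutions n" "nonnesting p" "i < p i"
  shows "rank {j. p j < j} (p i) = rank {j. j < p j} i"
proof -
  have inv: "p (p x) = x" for x using assms by (auto simp: involutions_iff)
  have "{j \<in> {j. p j < j}. j \<le> p i} = p ` {j \<in> {j. j < p j}. j \<le> i}" (is "?L = p ` ?R")
  proof (intro equalityI subsetI)
    fix j assume j: "j \<in> ?L"
    \<comment> \<open>Otherwise \<open>i < p j < j\<close>, and nonnesting at the opener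
      \<open>p j\<close> would give \<open>p i < j\<close>.\<close>
    then have "p j \<le> i"
      using assms(2,3) inv[of j] unfolding nonnesting_def by (metis (lifting) mem_Collect_eq not_le)
    then have "p j \<in> ?R" using j by (simp add: inv)
    then show "j \<in> p ` ?R" by (metis (lifting) imageI inv)
  next
    fix j assume "j \<in> p ` ?R"
    then show "j \<in> ?L"
      using assms(2,3) unfolding nonnesting_def by (auto simp: inv le_less)
  qed
  moreover have "inj_on p ?R"
    by (rule inj_on_inverseI[of _ p]) (rule inv)
  ultimately show ?thesis by (simp add: rank_def card_image)
qed

text \<open>Equal shapes give the same openers and closers. At an opener, the two images then have
  the same rank among the common closers and so coincide.\<close>

lemma inj_on_shape: "inj_on (shape n) {p \<in> involutions n. nonnesting p}"
proof (rule inj_onI)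
  fix p q
  assume p: "p \<in> {p \<in> involutions n. nonnesting p}" and q: "q \<in> {p \<in> involutions n. nonnesting p}"
    and eq: "shape n p = shape n q"
  have invp: "p (p x) = x" and invq: "q (q x) = x"
    and outp: "x \<notin> {1..n} \<Longrightarrow> p x = x" and outq: "x \<notin> {1..n} \<Longrightarrow> q x = x" for x
    using p q by (auto simp: involutions_iff)
  have step: "step_at p i = step_at q i" for i
  proof (cases "i \<in> {1..n}")
    case True
    then show ?thesis using eq by (auto simp: shape_def simp del: upt_Suc)
  next
    case False
    then show ?thesis by (simp add: step_at_def outp outq)
  qed
  have Up: "i < p i \<longleftrightarrow> i < q i" and Down: "p i < i \<longleftrightarrow> q i < i" for i
    using step[of i] by (auto simp: step_at_def split: if_splits)
  have "finite {i. p i < i}"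
    by (rule finite_subset[of _ "{1..n}"]) (use outp in force, simp)
  then have inj: "inj_on (rank {i. p i < i}) {i. p i < i}" by (rule inj_on_rank)
  have *: "p i = q i" if "i < p i" for i
  proof (rule inj_onD[OF inj])
    show "rank {i. p i < i} (p i) = rank {i. p i < i} (q i)"
      using rank_nonnesting[of p n i] rank_nonnesting[of q n i] p q that Up Down by simp
    show "p i \<in> {i. p i < i}" using that by (simp add: invp)
    show "q i \<in> {i. p i < i}" using that Up by (simp add: Down invq)
  qed
  show "p = q"
  proof
    fix i
    consider "i < p i" | "p i < i" | "p i = i" by linarith
    then show "p i = q i"
    proof cases
      case 2
      \<comment> \<open>Agreement at the left end \<open>p i\<close> of the arc gives
        \<open>q (p i) = i\<close>; applying \<open>q\<close> finishes.\<close>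
      then show ?thesis using *[of "p i"] invp invq by metis
    next
      case 3
      then show ?thesis using Up[of i] Down[of i] by simp
    qed (rule *)
  qed
qed

text \<open>The preimage matches the k-th up step with the k-th down step. The ballot condition
  makes each arc point to the right, and monotonicity of the matching excludes nesting.\<close>

lemma motzkin_paths_subset_shape:
  "motzkin_paths n \<subseteq> shape n ` {p \<in> involutions n. nonnesting p}"
proof
  fix s assume s: "s \<in> motzkin_paths n"
  define w where "w i = s ! (i - 1)" for i
  have sw: "s = map w [1..<Suc n]"
    using s by (intro nth_equalityI) (auto simp: w_def motzkin_paths_def simp del: upt_Suc)
  define A where "A = {i \<in> {1..n}. w i = Up}"
  define B where "B = {i \<in> {1..n}. w i = Down}"
  have fin: "finite A" "finite B" and disj: "A \<inter> B = {}" by (auto simp: A_def B_def)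
  have le: "rank B j \<le> rank A j" if "j \<le> n" for j
  proof -
    have "{i \<in> A. i \<le> j} = {i \<in> {1..j}. w i = Up}" "{i \<in> B. i \<le> j} = {i \<in> {1..j}. w i = Down}"
      using that by (auto simp: A_def B_def)
    then show ?thesis
      using s that unfolding sw motzkin_paths_map_iff rank_def by simp
  qed
  have card: "card A = card B"
    using s unfolding sw motzkin_paths_map_iff A_def B_def by simp
  define f where "f = inv_into B (rank B) \<circ> rank A"
  have "bij_betw (inv_into B (rank B)) {1..card A} B"
    using bij_betw_rank[OF fin(2)] by (simp add: card bij_betw_inv_into)
  then have f: "bij_betw f A B"
    unfolding f_def using bij_betw_rank[OF fin(1)] by (rule bij_betw_trans[rotated])
  have fB: "f i \<in> B" if "i \<in> A" for i using f that by (auto simp: bij_betw_def)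
  have rank_f: "rank B (f i) = rank A i" if "i \<in> A" for i
    using bij_betw_rank[OF fin(1)] bij_betw_rank[OF fin(2)] card that
    by (auto simp: f_def bij_betw_def intro!: f_inv_into_f)
  \<comment> \<open>If \<open>f i < i\<close>, the ballot condition at \<open>f i\<close> gives
    \<open>rank B (f i) \<le> rank A (f i) < rank A i\<close>, although the outer terms are
    equal.\<close>
  have less: "i < f i" if "i \<in> A" for i
  proof (rule ccontr)
    assume "\<not> i < f i"
    moreover have "f i \<noteq> i" using that fB disj by (metis disjoint_iff)
    ultimately have "f i < i" by simp
    then have "rank A (f i) < rank A i" using fin that by (intro rank_less)
    moreover have "rank B (f i) \<le> rank A (f i)" using fB[OF that] by (intro le) (simp add: B_def)
    ultimately show False using rank_f that by simp
  qed
  have mono: "f i < f j" if "i < j" "i \<in> A" "j \<in> A" for i j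
  proof (rule ccontr)
    assume "\<not> f i < f j"
    then have "rank B (f j) \<le> rank B (f i)"
      using fin by (auto simp: rank_def intro!: card_mono)
    then show False using rank_less[of A j i] fin that by (simp add: rank_f)
  qed
  define g where "g = inv_into A f"
  have gA: "g i \<in> A" and fg: "f (g i) = i" if "i \<in> B" for i
    using f that by (auto simp: g_def bij_betw_def inv_into_into f_inv_into_f)
  have gf: "g (f i) = i" if "i \<in> A" for i
    using f that by (auto simp: g_def bij_betw_def)
  define p where "p i = (if i \<in> A then f i else if i \<in> B then g i else i)" for i
  have pA: "p i = f i" if "i \<in> A" for i using that by (simp add: p_def)
  have pB: "p i = g i" if "i \<in> B" for i using that disj by (auto simp: p_def)
  have pC: "p i = i" if "i \<notin> A" "i \<notin> B" for i using that by (simp add: p_def)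
  have Down: "p i < i" if "i \<in> B" for i
    using less[OF gA[OF that]] by (simp add: pB fg that)
  have Up: "i < p i" if "i \<in> A" for i using less that by (simp add: pA)
  have "p (p i) = i" for i
    by (cases "i \<in> A"; cases "i \<in> B") (auto simp: pA pB pC fB gA fg gf)
  moreover have "p i = i" if "i \<notin> {1..n}" for i
    using that by (intro pC) (auto simp: A_def B_def)
  ultimately have "p \<in> involutions n" by (simp add: involutions_iff)
  moreover have "nonnesting p"
    unfolding nonnesting_def
  proof (intro allI impI, elim conjE)
    fix a b assume ab: "a < b" "b < p b"
    then have b: "b \<in> A" using Down[of b] pC[of b] by force
    \<comment> \<open>Only an opener \<open>a\<close> needs monotonicity of \<open>f\<close>;
      otherwise \<open>p a \<le> a < b < p b\<close>.\<close>
    consider "a \<in> A" | "a \<in> B" | "p a = a" using pC by blast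
    then show "p a < p b"
    proof cases
      case 1
      then show ?thesis using mono ab b by (simp add: pA)
    qed (use ab Down[of a] in auto)
  qed
  moreover have "shape n p = s"
  proof -
    have "step_at p i = w i" if "i \<in> {1..n}" for i
      using that Up[of i] Down[of i] pC[of i]
      by (cases "w i") (auto simp: step_at_def A_def B_def)
    then show ?thesis by (simp add: sw shape_def del: upt_Suc)
  qed
  ultimately show "s \<in> shape n ` {p \<in> involutions n. nonnesting p}" by blast
qed

theorem theorem5p4:
  fixes n :: nat
  assumes "n \<ge> 1"
  shows "int (card (RAI_avoiding (2 * n - 1) 4 (perm_of_word [4, 3, 2, 1])))
    = motzkin (int n) - motzkin (int n - 2)"
proof -
  let ?N = "2 * n - 1"
  let ?I = "{p \<in> involutions ?N. nonnesting p}"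
  have RAI: "RAI_avoiding ?N 4 (perm_of_word [4, 3, 2, 1]) =
      {p \<in> ?I. alternates True (shape ?N p)}"
    using avoids_decreasing_iff_nonnesting[of _ ?N] reverse_alternating_iff[of _ ?N]
    by (auto simp: RAI_avoiding_def RAI_def involutions_def)
  have "shape ?N ` ?I = motzkin_paths ?N"
    using motzkin_paths_subset_shape shape_in_motzkin_paths by blast
  \<comment> \<open>Alternation is a condition on the shape alone, so the bijection restricts to the
    alternating objects.\<close>
  then have "{s \<in> motzkin_paths ?N. alternates True s} =
      shape ?N ` {p \<in> ?I. alternates True (shape ?N p)}"
    by (auto simp del: One_nat_def)
  moreover have "inj_on (shape ?N) {p \<in> ?I. alternates True (shape ?N p)}"
    using inj_on_shape by (rule inj_on_subset) blast
  ultimately have "card {s \<in> motzkin_paths ?N. alternates True s} =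
      card {p \<in> ?I. alternates True (shape ?N p)}"
    by (simp only: card_image)
  then show ?thesis
    using card_alternating_motzkin_paths[OF assms] RAI by simp
qed

end
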